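(* Let $p$ be a prime, let $H$ be a subgroup of $\mathbb{F}_p^\times$, and let $\chi\colon H\to\mathbb{C}^\times$ be a character. Suppose that $f\colon\mathbb{F}_p\to\mathbb{C}$ is a $\chi$-symmetric function and $f\neq 0$. (i) If $\chi$ is nontrivial, then $$|\operatorname{supp}(f)|+|\operatorname{supp}(\widehat f)|\geq p+|H|-1.$$ (ii) If $\chi$ is trivial, then $$|\operatorname{supp}(f)|+|\operatorname{supp}(\widehat f)|\geq\begin{cases}p+2|H|-1 & \text{if } f(0)=0\text{ and }\widehat f(0)=0,\\ p+|H| & \text{if } f(0)=0\text{ or }\widehat f(0)=0,\\ p+1 & \text{otherwise.}\end{cases}$$
   Context: $\mathbb{F}_p=\mathbb{Z}/p\mathbb{Z}$. A character of $H$ is a group homomorphism $\chi\colon H\to\mathbb{C}^\times$; it is trivial if it is identically $1$. A function $f\colon\mathbb{F}_p\to\mathbb{C}$ is $\chi$-symmetric if $f(hx)=\chi(h)f(x)$ for every $h\in H$ and $x\in\mathbb{F}_p$. The Fourier transform of $f$ is $\widehat f\colon\mathbb{F}_p\to\mathbb{C}$, $\widehat f(a)=\sum_{b\in\mathbb{F}_p}f(b)\exp(-2\pi i ab/p)$. The support $\operatorname{supp}(f)$ is the set of points where $f$ is nonzero. The case distinctions are read in order: the second case applies when exactly one of $f(0),\widehat f(0)$ vanishes. *)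

theory Defs
  imports
    Complex_Main
    "HOL-Algebra.Group"
    "Berlekamp_Zassenhaus.Finite_Field"
begin

text \<open>
  The field with \<open>p\<close> elements is the type \<open>'p mod_ring\<close> with \<open>'p\<close> of class \<open>prime_card\<close>, so that
  \<open>p = CARD('p)\<close> is prime.
\<close>

definition mult_group :: "'a::field monoid" where
  "mult_group = \<lparr>carrier = UNIV - {0}, monoid.mult = (*), one = 1\<rparr>"

text \<open>Only the values of \<open>\<chi>\<close> on \<open>H\<close> are meaningful.\<close>

definition is_character :: "'a::field set \<Rightarrow> ('a \<Rightarrow> complex) \<Rightarrow> bool" where
  "is_character H \<chi> \<longleftrightarrow> \<chi> \<in> hom (mult_group\<lparr>carrier := H\<rparr>) mult_group"

definition trivial_character :: "'a set \<Rightarrow> ('a \<Rightarrow> complex) \<Rightarrow> bool" where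
  "trivial_character H \<chi> \<longleftrightarrow> (\<forall>h\<in>H. \<chi> h = 1)"

definition chi_symmetric :: "'a::field set \<Rightarrow> ('a \<Rightarrow> complex) \<Rightarrow> ('a \<Rightarrow> complex) \<Rightarrow> bool" where
  "chi_symmetric H \<chi> f \<longleftrightarrow> (\<forall>h\<in>H. \<forall>x. f (h * x) = \<chi> h * f x)"

definition supp :: "('a \<Rightarrow> complex) \<Rightarrow> 'a set" where
  "supp f = {x. f x \<noteq> 0}"

text \<open>
  \<open>to_int_mod_ring\<close> picks the representative in \<open>{0..<p}\<close>; the exponential depends only on the
  residue classes.
\<close>

definition fourier :: "('p::prime_card mod_ring \<Rightarrow> complex) \<Rightarrow> 'p mod_ring \<Rightarrow> complex" where
  "fourier f a =
    (\<Sum>b\<in>UNIV. f b * exp (- 2 * of_real pi * \<i> *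
       of_int (to_int_mod_ring a * to_int_mod_ring b) / of_nat CARD('p)))"

end

theory Submission
  imports Defs "Jordan_Normal_Form.Determinant"
begin

text \<open>
  Let \<open>w\<close> be the primitive \<open>p\<close>-th root of unity of the Fourier transform and let \<open>M\<close> be the
  \<open>\<int>[w]\<close>-submodule of \<open>\<complex>\<close> generated by the values of \<open>f\<close>. It is a nonzero finitely generated
  abelian group and \<open>(1 - w)\<^sup>p M \<subseteq> p M\<close>, so \<open>M \<noteq> N := (1 - w) M\<close> by Nakayama's lemma. Each
  zero \<open>a\<close> of the Fourier transform is a root \<open>w\<^sup>a\<close> of the polynomial \<open>\<Sum>b. f b * X\<^sup>b\<close>, and all
  these roots become \<open>1\<close> modulo \<open>1 - w\<close>. Hence the moments \<open>\<Sum>b. f b * b\<^sup>i\<close> lie in \<open>N\<close> for all \<open>i\<close>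
  smaller than the number of zeros. If this held for all \<open>i\<close> smaller than the size of the
  support, Lagrange interpolation modulo \<open>p\<close> would put every value of \<open>f\<close> in \<open>N\<close>. This yields
  the bound \<open>p + 1\<close>.

  Away from \<open>0\<close>, both supports are unions of \<open>H\<close>-orbits, and divisibility by the order of \<open>H\<close>
  improves the bound in all cases except the one of trivial \<open>\<chi>\<close> with \<open>f\<close> and its transform both
  vanishing at \<open>0\<close>. There the moments with \<open>i\<close> not divisible by \<open>card H\<close> lie in \<open>N\<close>
  automatically, because \<open>f\<close> is \<open>H\<close>-invariant; this gains one more orbit.
\<close>

section \<open>Nakayama's lemma over the integers\<close>

text \<open>For the vector \<open>v\<close> of elements of \<open>A\<close> the relations read
  \<open>v = p C v\<close> with an integer matrix \<open>C\<close>. The determinant of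
  \<open>1 - p C\<close> is 1 modulo \<open>p\<close>, hence nonzero, and so
  \<open>v = 0\<close>.\<close>

lemma nakayama_int_span:
  fixes A :: "complex set" and p :: int
  assumes fin: "finite A" and p: "\<not> p dvd 1"
    and rel: "\<And>a. a \<in> A \<Longrightarrow> \<exists>c. a = of_int p * (\<Sum>b\<in>A. of_int (c b) * b)"
  shows "A \<subseteq> {0}"
proof (rule ccontr)
  assume nz: "\<not> A \<subseteq> {0}"
  obtain xs where xs: "set xs = A" "distinct xs" using finite_distinct_list[OF fin] by blast
  define n where "n = length xs"
  obtain c where c: "\<And>a. a \<in> A \<Longrightarrow> a = of_int p * (\<Sum>b\<in>A. of_int (c a b) * b)"
    using rel by metis
  \<comment> \<open>\<open>P\<close> is \<open>1 - X C\<close> with \<open>X\<close> kept as a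
    variable: \<open>det P\<close> is 1 at 0, and an integer polynomial takes congruent values at
    \<open>p\<close> and at 0 modulo \<open>p\<close>.\<close>
  define P :: "int poly mat" where
    "P = mat n n (\<lambda>(i, j). (if i = j then 1 else 0) - monom (c (xs ! i) (xs ! j)) 1)"
  define v where "v = vec n (\<lambda>i. xs ! i)"
  define B where "B t = map_mat (\<lambda>q. poly q t) P" for t
  have P: "P \<in> carrier_mat n n" by (simp add: P_def)
  have det_B: "det (B t) = poly (det P) t" for t
    unfolding B_def by (rule comm_ring_hom.hom_det) (unfold_locales, auto)
  have "B 0 = 1\<^sub>m n" by (rule eq_matI) (auto simp: B_def P_def poly_monom)
  hence "poly (det P) 0 = 1" using det_B[of 0] by simp
  moreover have "p dvd poly (det P) p - poly (det P) 0"
    by (cases "det P") simp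
  ultimately have det_nz: "poly (det P) p \<noteq> 0"
    using p by (metis dvd_diff_commute diff_zero)
  define D :: "complex mat" where "D = map_mat of_int (B p)"
  have D: "D \<in> carrier_mat n n" using P by (simp add: D_def B_def)
  have "D *\<^sub>v v = 0\<^sub>v n"
  proof (rule eq_vecI)
    fix i assume "i < dim_vec (0\<^sub>v n :: complex vec)"
    hence i: "i < n" by simp
    have "(D *\<^sub>v v) $ i = (\<Sum>j<n. D $$ (i, j) * xs ! j)"
      using i D by (simp add: scalar_prod_def v_def atLeast0LessThan)
    also have "\<dots> = (\<Sum>j<n. (if i = j then xs ! j else 0) - of_int p * (of_int (c (xs!i) (xs!j)) * xs!j))"
      using i by (intro sum.cong) (auto simp: D_def B_def P_def poly_monom algebra_simps)
    also have "\<dots> = xs ! i - of_int p * (\<Sum>j<n. of_int (c (xs!i) (xs!j)) * xs!j)"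
      using i by (simp add: sum_subtractf sum_distrib_left)
    also have "(\<Sum>j<n. of_int (c (xs!i) (xs!j)) * xs!j) = (\<Sum>b\<in>A. of_int (c (xs!i) b) * b)"
      using bij_betw_nth[OF xs(2), of "{..<n}" A] xs n_def
      by (intro sum.reindex_bij_betw) auto
    also have "xs ! i - of_int p * \<dots> = 0"
      using c[of "xs ! i"] i xs n_def by auto
    finally show "(D *\<^sub>v v) $ i = 0\<^sub>v n $ i" using i by simp
  qed (use D in auto)
  moreover have "v \<noteq> 0\<^sub>v n"
  proof
    assume v0: "v = 0\<^sub>v n"
    have "xs ! i = 0" if "i < n" for i
      using arg_cong[OF v0, of "\<lambda>u. u $ i"] that by (simp add: v_def)
    with nz xs n_def show False by (auto simp: in_set_conv_nth)
  qed
  moreover have "v \<in> carrier_vec n" by (simp add: v_def)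
  ultimately have "det D = 0" using det_0_iff_vec_prod_zero[OF D] by blast
  moreover have "det D = of_int (poly (det P) p)"
    unfolding D_def using of_int_hom.hom_det det_B by metis
  ultimately show False using det_nz by simp
qed

subsection \<open>Moments of polynomials\<close>

lemma sum_shift_power:
  fixes g :: "nat \<Rightarrow> 'a::comm_ring_1"
  shows "(\<Sum>n\<le>d. g n * of_nat (Suc n) ^ i) = (\<Sum>l\<le>i. of_nat (i choose l) * (\<Sum>n\<le>d. g n * of_nat n ^ l))"
proof -
  have "(\<Sum>n\<le>d. g n * of_nat (Suc n) ^ i) = (\<Sum>n\<le>d. \<Sum>l\<le>i. of_nat (i choose l) * (g n * of_nat n ^ l))"
  proof (rule sum.cong)
    fix n
    have "(of_nat (Suc n) :: 'a) ^ i = (of_nat n + 1) ^ i" by (simp add: add.commute)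
    also have "\<dots> = (\<Sum>l\<le>i. of_nat (i choose l) * of_nat n ^ l)" by (simp add: binomial_ring)
    finally show "g n * of_nat (Suc n) ^ i = (\<Sum>l\<le>i. of_nat (i choose l) * (g n * of_nat n ^ l))"
      by (simp add: sum_distrib_left algebra_simps)
  qed simp
  also have "\<dots> = (\<Sum>l\<le>i. \<Sum>n\<le>d. of_nat (i choose l) * (g n * of_nat n ^ l))" by (rule sum.swap)
  finally show ?thesis by (simp add: sum_distrib_left)
qed

text \<open>This is the value at 1 of \<open>A\<close> after \<open>i\<close> applications of the
  operator X d/dX. Plain powers of \<open>n\<close>, rather than the falling factorials of iterated
  derivatives, suit the interpolation that follows.\<close>

definition moment :: "nat \<Rightarrow> 'a::comm_ring_1 poly \<Rightarrow> 'a" where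
  "moment i A = (\<Sum>n\<le>degree A. coeff A n * of_nat n ^ i)"

lemma moment_altdef:
  assumes "degree A \<le> d"
  shows "moment i A = (\<Sum>n\<le>d. coeff A n * of_nat n ^ i)"
  unfolding moment_def using assms by (intro sum.mono_neutral_left) (auto simp: coeff_eq_0)

lemma moment_0: "moment i 0 = 0"
  by (simp add: moment_def)

lemma moment_diff: "moment i (A - B) = moment i A - moment i B"
proof -
  define d where "d = max (degree A) (degree B)"
  have "degree (A - B) \<le> d" using degree_diff_le_max[of A B] by (simp add: d_def)
  thus ?thesis
    using moment_altdef[of A d i] moment_altdef[of B d i] moment_altdef[of "A - B" d i]
    by (simp add: d_def algebra_simps sum_subtractf)
qed

lemma moment_smult: "moment i (smult c A) = c * moment i A"
  using moment_altdef[OF degree_smult_le, of i c A]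
  by (simp add: moment_def sum_distrib_left mult.assoc)

lemma moment_add: "moment i (A + B) = moment i A + moment i B"
  using moment_diff[of i A "smult (-1) B"] moment_smult[of i "-1" B] by simp

lemma moment_monom: "moment i (monom c m) = c * of_nat m ^ i"
proof -
  have "moment i (monom c m) = (\<Sum>n\<le>m. coeff (monom c m) n * of_nat n ^ i)"
    by (intro moment_altdef degree_monom_le)
  also have "\<dots> = (\<Sum>n\<in>{m}. coeff (monom c m) n * of_nat n ^ i)"
    by (intro sum.mono_neutral_right) auto
  finally show ?thesis by simp
qed

lemma moment_sum: "moment i (\<Sum>b\<in>B. F b) = (\<Sum>b\<in>B. moment i (F b))"
  by (induction B rule: infinite_finite_induct) (auto simp: moment_add moment_0)

lemma moment_X_mult: "moment i (pCons 0 A) = (\<Sum>l\<le>i. of_nat (i choose l) * moment l A)"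
proof -
  have "moment i (pCons 0 A) = (\<Sum>n\<le>Suc (degree A). coeff (pCons 0 A) n * of_nat n ^ i)"
    by (intro moment_altdef degree_pCons_le)
  also have "\<dots> = (\<Sum>n\<le>degree A. coeff A n * of_nat (Suc n) ^ i)"
    by (subst sum.atMost_Suc_shift) simp
  also have "\<dots> = (\<Sum>l\<le>i. of_nat (i choose l) * moment l A)"
    unfolding moment_def by (rule sum_shift_power)
  finally show ?thesis .
qed

text \<open>Multiplication by \<open>X\<close> shifts exponents, and the top term of the binomial
  expansion merges with \<open>- c\<close>. The moment of the same order thus survives only with the
  factor \<open>1 - c\<close>, a multiple of \<open>1 - w\<close> when \<open>c\<close> is a power
  of \<open>w\<close>.\<close>

lemma moment_linear_factor_mult:
  "moment i ([:-c, 1:] * A) = (\<Sum>l<i. of_nat (i choose l) * moment l A) + (1 - c) * moment i A"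
proof -
  have "[:-c, 1:] * A = pCons 0 A - smult c A" by simp
  thus ?thesis
    by (simp add: moment_diff moment_smult moment_X_mult algebra_simps
        flip: lessThan_Suc_atMost)
qed

subsection \<open>Reduction modulo \<open>1 - w\<close>\<close>

text \<open>Closure under differences and under \<open>w\<close> makes \<open>M\<close> a module
  over Z[w]; \<open>w_pow_p\<close> and \<open>inj_w\<close> make \<open>w\<close> a primitive
  \<open>p\<close>-th root of unity.\<close>

locale cyclotomic_module =
  fixes p :: nat and w :: complex and M :: "complex set"
  assumes prime_p: "prime p" and w_pow_p: "w ^ p = 1"
    and zero_mem: "0 \<in> M"
    and diff_mem: "x \<in> M \<Longrightarrow> y \<in> M \<Longrightarrow> x - y \<in> M"
    and w_mult_mem: "x \<in> M \<Longrightarrow> w * x \<in> M"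
    and inj_w: "inj_on (\<lambda>n. w ^ n) {..<p}"
begin

lemma add_mem: "x \<in> M \<Longrightarrow> y \<in> M \<Longrightarrow> x + y \<in> M"
  using diff_mem[of x "0 - y"] diff_mem[of 0 y] zero_mem by simp

lemma of_nat_mult_mem: "x \<in> M \<Longrightarrow> of_nat n * x \<in> M"
  by (induction n) (auto simp: zero_mem add_mem algebra_simps)

lemma of_int_mult_mem: "x \<in> M \<Longrightarrow> of_int n * x \<in> M"
  using of_nat_mult_mem[of x] diff_mem[OF zero_mem, of "of_nat k * x" for k]
  by (cases n rule: int_cases2) auto

lemma w_pow_mult_mem: "x \<in> M \<Longrightarrow> w ^ n * x \<in> M"
  by (induction n) (auto simp: w_mult_mem mult.assoc)

lemma sum_mem: "(\<And>i. i \<in> I \<Longrightarrow> g i \<in> M) \<Longrightarrow> sum g I \<in> M"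
  by (induction I rule: infinite_finite_induct) (auto simp: zero_mem add_mem)

definition N where "N = (\<lambda>x. (1 - w) * x) ` M"

lemma zero_N: "0 \<in> N"
  unfolding N_def using zero_mem by force

lemma diff_N:
  assumes "x \<in> N" "y \<in> N"
  shows "x - y \<in> N"
proof -
  obtain a b where "a \<in> M" "b \<in> M" "x = (1 - w) * a" "y = (1 - w) * b"
    using assms by (auto simp: N_def)
  hence "x - y = (1 - w) * (a - b)" "a - b \<in> M" using diff_mem by (auto simp: algebra_simps)
  thus ?thesis unfolding N_def by blast
qed

lemma add_N: "x \<in> N \<Longrightarrow> y \<in> N \<Longrightarrow> x + y \<in> N"
  using diff_N[of x "0 - y"] diff_N[of 0 y] zero_N by simp

lemma of_int_mult_N:
  assumes "x \<in> N"
  shows "of_int n * x \<in> N"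
proof -
  obtain a where "a \<in> M" "x = (1 - w) * a" using assms by (auto simp: N_def)
  hence "of_int n * x = (1 - w) * (of_int n * a)" "of_int n * a \<in> M"
    using of_int_mult_mem by auto
  thus ?thesis unfolding N_def by blast
qed

lemma sum_N: "(\<And>i. i \<in> I \<Longrightarrow> g i \<in> N) \<Longrightarrow> sum g I \<in> N"
  by (induction I rule: infinite_finite_induct) (auto simp: zero_N add_N)

lemma one_minus_w_pow_mult_N:
  assumes "x \<in> M"
  shows "(1 - w ^ n) * x \<in> N"
proof (induction n)
  case (Suc n)
  have "(1 - w ^ Suc n) * x = (1 - w ^ n) * x + (1 - w) * (w ^ n * x)"
    by (simp add: algebra_simps)
  moreover have "(1 - w) * (w ^ n * x) \<in> N"
    unfolding N_def using w_pow_mult_mem[OF assms] by blast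
  ultimately show ?case using Suc add_N by simp
qed (simp add: zero_N)

lemma w_neq_1: "w \<noteq> 1"
  using inj_onD[OF inj_w, of 0 1] prime_gt_1_nat[OF prime_p] by auto

text \<open>The \<open>p\<close> powers of \<open>w\<close> sum to 0, so \<open>p\<close> is the sum
  of \<open>1 - w ^ k\<close> over \<open>k < p\<close>.\<close>

lemma p_mult_N:
  assumes "x \<in> M"
  shows "of_nat p * x \<in> N"
proof -
  have "(\<Sum>k<p. w ^ k) = 0" using w_neq_1 by (simp add: geometric_sum w_pow_p)
  hence "of_nat p * x = (\<Sum>k<p. (1 - w ^ k) * x)"
    by (simp add: sum_distrib_right[symmetric] sum_subtractf)
  thus ?thesis using one_minus_w_pow_mult_N[OF assms] by (simp add: sum_N)
qed

text \<open>As \<open>p\<close> annihilates M/N, Bezout's identity makes integers prime to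
  \<open>p\<close> act invertibly on it.\<close>

lemma mem_N_of_int_mult:
  assumes x: "x \<in> M" and "of_int n * x \<in> N" and "\<not> int p dvd n"
  shows "x \<in> N"
proof -
  have "coprime (int p) n"
    using assms(3) prime_p by (intro prime_imp_coprime) auto
  then obtain u v where uv: "u * int p + v * n = 1"
    using bezout_int[of "int p" n] by auto
  have "x = of_int (u * int p + v * n) * x" using uv by simp
  also have "\<dots> = of_int u * (of_nat p * x) + of_int v * (of_int n * x)"
    by (simp add: algebra_simps)
  finally show ?thesis
    using add_N[OF of_int_mult_N[OF p_mult_N[OF x]] of_int_mult_N[OF assms(2)], of u v] by simp
qed

lemma poly_w_pow_mem:
  assumes "\<And>n. coeff F n \<in> M"
  shows "poly F (w ^ a) \<in> M"
  using assms unfolding poly_altdef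
  by (intro sum_mem) (metis mult.commute power_mult w_pow_mult_mem)

text \<open>By Horner's scheme, the coefficients of the quotient are the values at
  \<open>w ^ a\<close> of the tails of \<open>F\<close>.\<close>

lemma coeff_synthetic_div_mem:
  assumes "\<And>n. coeff F n \<in> M"
  shows "coeff (synthetic_div F (w ^ a)) n \<in> M"
  using assms
proof (induction F arbitrary: n)
  case (pCons c F)
  have F: "coeff F n \<in> M" for n using pCons.prems[of "Suc n"] by simp
  show ?case using poly_w_pow_mem[OF F] pCons.IH[OF F]
    by (cases n) auto
qed (simp add: zero_mem)

lemma moment_mem:
  assumes "\<And>n. coeff F n \<in> M"
  shows "moment i F \<in> M"
  unfolding moment_def using assms of_nat_mult_mem
  by (intro sum_mem) (metis mult.commute of_nat_power)

text \<open>Modulo \<open>1 - w\<close> all the roots \<open>w ^ a\<close> collapse to \<open>1\<close>, so \<open>F\<close> vanishes to order \<open>card Z\<close> there.\<close>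

lemma moment_N_of_roots:
  assumes "finite Z" "Z \<subseteq> {..<p}" "\<And>n. coeff F n \<in> M" "\<And>a. a \<in> Z \<Longrightarrow> poly F (w ^ a) = 0"
    and "i < card Z"
  shows "moment i F \<in> N"
  using assms
proof (induction Z arbitrary: F i rule: finite_induct)
  case (insert a Z)
  define G where "G = synthetic_div F (w ^ a)"
  have F: "F = [:- (w ^ a), 1:] * G"
    using synthetic_div_correct'[of "w ^ a" F] insert.prems by (simp add: G_def)
  have G: "coeff G n \<in> M" for n
    unfolding G_def using insert.prems by (intro coeff_synthetic_div_mem)
  have "poly G (w ^ b) = 0" if "b \<in> Z" for b
  proof -
    have "w ^ b \<noteq> w ^ a"
      using inj_onD[OF inj_w, of b a] that insert by auto
    thus ?thesis using insert.prems(3)[of b] that by (simp add: F)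
  qed
  hence IH: "moment l G \<in> N" if "l < card Z" for l
    using that G insert by auto
  \<comment> \<open>Here \<open>i \<le> card Z\<close>, so the induction hypothesis covers all
    \<open>l < i\<close>. The \<open>i\<close>-th moment of \<open>G\<close> is only known to lie in
    \<open>M\<close>, but the factor \<open>1 - w ^ a\<close> moves it into
    \<open>N\<close>.\<close>
  have "moment i F = (\<Sum>l<i. of_nat (i choose l) * moment l G) + (1 - w ^ a) * moment i G"
    unfolding F by (rule moment_linear_factor_mult)
  moreover have "(\<Sum>l<i. of_nat (i choose l) * moment l G) \<in> N"
    using insert of_int_mult_N[OF IH, of _ "int (i choose _)"] by (intro sum_N) auto
  ultimately show ?case
    using add_N one_minus_w_pow_mult_N[OF moment_mem[OF G]] by auto
qed simp

text \<open>The inner binomial coefficients are divisible by \<open>p\<close>, and the outer terms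
  \<open>1 + (- w) ^ p\<close> give 0 for odd \<open>p\<close> and 2 for
  \<open>p = 2\<close>.\<close>

lemma one_minus_w_pow_p_mult:
  assumes "x \<in> M"
  shows "\<exists>y\<in>M. (1 - w) ^ p * x = of_nat p * y"
proof -
  have "\<exists>y\<in>M. of_nat (p choose k) * (- w) ^ k * x = of_nat p * y" if "0 < k" "k < p" for k
  proof -
    have "p dvd p choose k" using that prime_p by (intro dvd_choose_prime) auto
    then obtain m where m: "p choose k = p * m" by blast
    have "of_nat (p choose k) * (- w) ^ k * x = of_nat p * (of_int (int m * (- 1) ^ k) * (w ^ k * x))"
      by (simp add: m power_minus[of w] mult_ac)
    thus ?thesis using of_int_mult_mem[OF w_pow_mult_mem[OF assms]] by blast
  qed
  then obtain g where g:
    "\<And>k. 0 < k \<Longrightarrow> k < p \<Longrightarrow> g k \<in> M \<and> of_nat (p choose k) * (- w) ^ k * x = of_nat p * g k"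
    by metis
  have p: "0 < p" using prime_p by (rule prime_gt_0_nat)
  have "(1 - w) ^ p = (\<Sum>k\<le>p. of_nat (p choose k) * (- w) ^ k)"
    using binomial_ring[of "- w" 1 p] by simp
  also have "{..p} = insert 0 (insert p {0<..<p})" using p by auto
  also have "(\<Sum>k\<in>\<dots>. of_nat (p choose k) * (- w) ^ k)
      = 1 + (- w) ^ p + (\<Sum>k\<in>{0<..<p}. of_nat (p choose k) * (- w) ^ k)"
    using p by simp
  finally have "(1 - w) ^ p * x = (1 + (- w) ^ p) * x + of_nat p * (\<Sum>k\<in>{0<..<p}. g k)"
    using g by (simp add: algebra_simps sum_distrib_left sum_distrib_right)
  moreover obtain y where "y \<in> M" "(1 + (- w) ^ p) * x = of_nat p * y"
  proof (cases "p = 2")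
    case True
    hence "(1 + (- w) ^ p) * x = of_nat p * x" using w_pow_p by simp
    thus ?thesis using assms that by blast
  next
    case False
    hence "odd p" using primes_dvd_imp_eq[OF two_is_prime_nat prime_p] by auto
    hence "(1 + (- w) ^ p) * x = of_nat p * 0" using w_pow_p by simp
    thus ?thesis using zero_mem that by blast
  qed
  moreover have "(\<Sum>k\<in>{0<..<p}. g k) \<in> M" using g by (intro sum_mem) auto
  ultimately have "(1 - w) ^ p * x = of_nat p * (y + (\<Sum>k\<in>{0<..<p}. g k))"
      "y + (\<Sum>k\<in>{0<..<p}. g k) \<in> M"
    by (simp_all add: distrib_left add_mem)
  thus ?thesis by blast
qed

text \<open>Iterating \<open>M \<subseteq> N\<close> shows that every element of \<open>M\<close> is
  a multiple of \<open>(1 - w) ^ p\<close> in \<open>M\<close>, hence of \<open>p\<close>, and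
  Nakayama's lemma applies to the generators.\<close>

lemma M_trivial_if_subset_N:
  assumes "M \<subseteq> N" and fin: "finite A"
    and span: "M = {\<Sum>a\<in>A. of_int (c a) * a | c. True}"
  shows "M = {0}"
proof -
  have A: "A \<subseteq> {0}"
  proof (rule nakayama_int_span[OF fin])
    show "\<not> int p dvd 1" using prime_gt_1_nat[OF prime_p] by simp
    fix a assume a: "a \<in> A"
    have "a = (\<Sum>b\<in>A. of_int (if b = a then 1 else 0) * b)"
      using fin a by (simp add: if_distrib[of of_int] if_distrib[of "\<lambda>x. x * _"] cong: if_cong)
    hence aM: "a \<in> M" unfolding span by (intro CollectI exI[of _ "\<lambda>b. if b = a then 1 else 0"]) simp
    have "\<exists>y\<in>M. a = (1 - w) ^ n * y" for n
    proof (induction n)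
      case (Suc n)
      then obtain y where "y \<in> M" "a = (1 - w) ^ n * y" by blast
      moreover from this obtain z where "z \<in> M" "y = (1 - w) * z"
        using assms(1) by (auto simp: N_def)
      ultimately show ?case by (intro bexI[of _ z]) (auto simp: mult_ac)
    qed (use aM in auto)
    then obtain y where "y \<in> M" "a = of_nat p * y" using one_minus_w_pow_p_mult by metis
    thus "\<exists>c. a = of_int (int p) * (\<Sum>b\<in>A. of_int (c b) * b)" unfolding span by auto
  qed
  hence "(\<Sum>a\<in>A. of_int (c a) * a) = 0" for c using A by (intro sum.neutral) auto
  thus ?thesis using zero_mem span by auto
qed

text \<open>An integer polynomial \<open>Q\<close> of degree below \<open>card S\<close> turns the
  moments into the sum of \<open>g j * Q (r j)\<close>, still in \<open>N\<close>. If
  \<open>Q\<close> vanishes at all nodes but \<open>r k\<close>, only \<open>Q (r k) * g k\<close>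
  remains, and \<open>Q (r k)\<close> is prime to \<open>p\<close>.\<close>

lemma mem_N_of_moments:
  fixes g :: "'j \<Rightarrow> complex" and r :: "'j \<Rightarrow> int"
  assumes S: "finite S" and g: "\<And>j. j \<in> S \<Longrightarrow> g j \<in> M"
    and r: "\<And>i j. i \<in> S \<Longrightarrow> j \<in> S \<Longrightarrow> i \<noteq> j \<Longrightarrow> \<not> int p dvd r i - r j"
    and mom: "\<And>i. i < card S \<Longrightarrow> (\<Sum>j\<in>S. g j * of_int (r j ^ i)) \<in> N"
    and k: "k \<in> S"
  shows "g k \<in> N"
proof -
  \<comment> \<open>the numerator of the Lagrange basis polynomial at \<open>r k\<close>\<close>
  define Q where "Q = (\<Prod>j\<in>S-{k}. [:- r j, 1:])"
  have "degree Q \<le> (\<Sum>j\<in>S-{k}. 1)"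
    unfolding Q_def using degree_prod_sum_le[of "S-{k}" "\<lambda>j. [:- r j, 1:]"] S by (simp add: o_def)
  hence deg: "degree Q < card S" using S k card_Diff1_less[OF S k] by simp
  have "(\<Sum>j\<in>S. g j * of_int (poly Q (r j)))
      = (\<Sum>j\<in>S. \<Sum>i\<le>degree Q. of_int (coeff Q i) * (g j * of_int (r j ^ i)))"
    by (simp add: poly_altdef sum_distrib_left mult_ac)
  also have "\<dots> = (\<Sum>i\<le>degree Q. \<Sum>j\<in>S. of_int (coeff Q i) * (g j * of_int (r j ^ i)))"
    by (rule sum.swap)
  also have "\<dots> = (\<Sum>i\<le>degree Q. of_int (coeff Q i) * (\<Sum>j\<in>S. g j * of_int (r j ^ i)))"
    by (simp add: sum_distrib_left)
  also have "\<dots> \<in> N" using deg by (intro sum_N of_int_mult_N mom) auto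
  also have "(\<Sum>j\<in>S. g j * of_int (poly Q (r j))) = (\<Sum>j\<in>{k}. g j * of_int (poly Q (r j)))"
    using S k by (intro sum.mono_neutral_right) (auto simp: Q_def poly_prod prod_zero_iff)
  finally have "of_int (poly Q (r k)) * g k \<in> N" by (simp add: mult.commute)
  moreover have "\<not> int p dvd poly Q (r k)"
    using r k S prime_p by (auto simp: Q_def poly_prod prime_dvd_prod_iff)
  ultimately show ?thesis using mem_N_of_int_mult[OF g[OF k]] by blast
qed

end

subsection \<open>The Fourier transform over the prime field\<close>

interpretation int_module: Modules.module "\<lambda>n x. of_int n * (x :: complex)"
  by standard (auto simp: algebra_simps)

definition root_p :: "'p::prime_card itself \<Rightarrow> complex" where
  "root_p _ = exp (- 2 * of_real pi * \<i> / of_nat CARD('p))"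

abbreviation nat_rep :: "'p::prime_card mod_ring \<Rightarrow> nat" where
  "nat_rep x \<equiv> nat (to_int_mod_ring x)"

lemma to_int_mod_ring_range:
  "0 \<le> to_int_mod_ring (x :: 'p::prime_card mod_ring)" "to_int_mod_ring x < int CARD('p)"
  using range_to_int_mod_ring[where 'a = 'p] by auto

lemma int_nat_rep: "int (nat_rep x) = to_int_mod_ring (x :: 'p::prime_card mod_ring)"
  using to_int_mod_ring_range[of x] by simp

lemma of_int_rep:
  "of_int (to_int_mod_ring (x :: 'p::prime_card mod_ring)) = (of_nat (nat_rep x) :: complex)"
  using int_nat_rep[of x] of_int_of_nat_eq by metis

lemma of_int_to_int_mod_ring: "of_int (to_int_mod_ring x) = (x :: 'p::prime_card mod_ring)"
  by (simp add: of_int_of_int_mod_ring)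

lemma nat_rep_less: "nat_rep (x :: 'p::prime_card mod_ring) < CARD('p)"
  using to_int_mod_ring_range[of x] by linarith

lemma inj_nat_rep: "inj (nat_rep :: 'p::prime_card mod_ring \<Rightarrow> nat)"
  by (intro injI) (metis int_nat_rep of_int_to_int_mod_ring)

lemma of_int_mod_ring_eq_iff_dvd:
  "(of_int m :: 'p::prime_card mod_ring) = of_int n \<longleftrightarrow> int CARD('p) dvd m - n"
  by (simp add: of_int_eq_iff_cong_CHAR cong_iff_dvd_diff)

lemma root_p_pow: "root_p TYPE('p::prime_card) ^ CARD('p) = 1"
proof -
  have "root_p TYPE('p) ^ CARD('p) = exp (of_nat CARD('p) * (- 2 * of_real pi * \<i> / of_nat CARD('p)))"
    unfolding root_p_def exp_of_nat_mult ..
  also have "of_nat CARD('p) * (- 2 * of_real pi * \<i> / of_nat CARD('p)) = - (2 * of_real pi * \<i>)"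
    by simp
  also have "exp \<dots> = 1" by (simp add: exp_minus exp_two_pi_i)
  finally show ?thesis .
qed

lemma root_p_pow_mod: "root_p TYPE('p::prime_card) ^ (n mod CARD('p)) = root_p TYPE('p) ^ n"
proof -
  have "root_p TYPE('p) ^ n = root_p TYPE('p) ^ (CARD('p) * (n div CARD('p)) + n mod CARD('p))"
    by simp
  thus ?thesis unfolding power_add power_mult root_p_pow by simp
qed

lemma inj_root_p: "inj_on (\<lambda>n. root_p TYPE('p::prime_card) ^ n) {..<CARD('p)}"
proof -
  have "root_p TYPE('p) ^ n = cnj (cis (2 * pi * real n / real CARD('p)))" for n
    unfolding root_p_def exp_of_nat_mult[symmetric] cis_cnj
    by (simp add: cis_conv_exp field_simps)
  thus ?thesis
    using bij_betw_imp_inj_on[OF Complex.bij_betw_roots_unity[of "CARD('p)"]]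
    by (auto simp: inj_on_def)
qed

text \<open>Including all powers of the root makes the integer span closed under multiplication by
  it while keeping the generating set finite.\<close>

definition value_gens :: "('p::prime_card mod_ring \<Rightarrow> complex) \<Rightarrow> complex set" where
  "value_gens f = (\<lambda>(j, k). f j * root_p TYPE('p) ^ k) ` (UNIV \<times> {..<CARD('p)})"

abbreviation value_module :: "('p::prime_card mod_ring \<Rightarrow> complex) \<Rightarrow> complex set" where
  "value_module f \<equiv> int_module.span (value_gens f)"

lemma finite_value_gens: "finite (value_gens f)"
  unfolding value_gens_def by simp

lemma root_p_mult_value_gens:
  assumes "x \<in> value_gens (f :: 'p::prime_card mod_ring \<Rightarrow> complex)"
  shows "root_p TYPE('p) * x \<in> value_gens f"
proof -
  obtain j k where "x = f j * root_p TYPE('p) ^ k" using assms by (auto simp: value_gens_def)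
  hence "root_p TYPE('p) * x = f j * root_p TYPE('p) ^ (Suc k mod CARD('p))"
    unfolding root_p_pow_mod by simp
  thus ?thesis unfolding value_gens_def by (auto intro!: image_eqI[of _ _ "(j, Suc k mod CARD('p))"])
qed

lemma value_mem: "f x \<in> value_module (f :: 'p::prime_card mod_ring \<Rightarrow> complex)"
  by (intro int_module.span_base) (auto simp: value_gens_def intro!: image_eqI[of _ _ "(x, 0)"])

lemma cyclotomic_value_module:
  fixes f :: "'p::prime_card mod_ring \<Rightarrow> complex"
  shows "cyclotomic_module CARD('p) (root_p TYPE('p)) (value_module f)"
proof
  fix x assume "x \<in> value_module f"
  thus "root_p TYPE('p) * x \<in> value_module f"
  proof (induction rule: int_module.span_induct_alt)
    case (step c x y)
    have "root_p TYPE('p) * (of_int c * x + y)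
        = of_int c * (root_p TYPE('p) * x) + root_p TYPE('p) * y"
      by (simp add: algebra_simps)
    thus ?case using step root_p_mult_value_gens
      by (metis int_module.span_add int_module.span_base int_module.span_scale)
  qed (simp add: int_module.span_zero)
qed (simp_all add: prime_card root_p_pow int_module.span_zero int_module.span_diff inj_root_p)

lemma fourier_altdef:
  fixes f :: "'p::prime_card mod_ring \<Rightarrow> complex"
  shows "fourier f a = (\<Sum>b\<in>UNIV. f b * root_p TYPE('p) ^ (nat_rep a * nat_rep b))"
  unfolding fourier_def root_p_def exp_of_nat_mult[symmetric]
  by (intro sum.cong refl) (simp add: of_int_rep mult_ac)

text \<open>The kernel depends only on the product of its arguments in the field, so
  \<open>b\<close> may be replaced by \<open>h * b\<close>. The transform is therefore symmetric for
  the inverse character.\<close>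

lemma fourier_scale:
  fixes f :: "'p::prime_card mod_ring \<Rightarrow> complex"
  assumes f: "\<And>x. f (h * x) = c * f x" and h: "h \<noteq> 0"
  shows "c * fourier f (h * a) = fourier f a"
proof -
  let ?e = "\<lambda>x :: 'p mod_ring. root_p TYPE('p) ^ nat_rep x"
  have nat_rep_mult: "nat_rep (x * y) = nat_rep x * nat_rep y mod CARD('p)" for x y :: "'p mod_ring"
    by (simp add: to_int_mod_ring_mult nat_mod_distrib nat_mult_distrib to_int_mod_ring_range)
  have e: "fourier f a = (\<Sum>b\<in>UNIV. f b * ?e (a * b))" for a
    unfolding fourier_altdef nat_rep_mult root_p_pow_mod ..
  have bij: "bij_betw (\<lambda>b. h * b) UNIV UNIV"
    using h by (intro bij_betwI[of _ _ _ "\<lambda>b. b / h"]) auto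
  have "c * fourier f (h * a) = (\<Sum>b\<in>UNIV. f (h * b) * ?e (a * (h * b)))"
    unfolding e f by (simp add: sum_distrib_left mult_ac)
  also have "\<dots> = (\<Sum>b\<in>UNIV. f b * ?e (a * b))"
    using sum.reindex_bij_betw[OF bij, of "\<lambda>b. f b * ?e (a * b)"] by simp
  finally show ?thesis unfolding e .
qed

section \<open>Moments of the values of \<open>f\<close> and the bound \<open>p + 1\<close>\<close>

context
  fixes f :: "'p::prime_card mod_ring \<Rightarrow> complex"
begin

interpretation V: cyclotomic_module "CARD('p)" "root_p TYPE('p)" "value_module f"
  by (rule cyclotomic_value_module)

definition value_moment :: "nat \<Rightarrow> complex" where
  "value_moment i = (\<Sum>b\<in>UNIV. f b * of_int (to_int_mod_ring b ^ i))"

lemma value_moment_mem: "value_moment i \<in> value_module f"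
  unfolding value_moment_def using V.of_int_mult_mem[OF value_mem]
  by (intro V.sum_mem) (simp only: mult.commute[of "f _"])

lemma value_moment_N_of_fourier_zeros:
  assumes "i < card {a. fourier f a = 0}"
  shows "value_moment i \<in> V.N"
proof -
  define F where "F = (\<Sum>b\<in>UNIV. monom (f b) (nat_rep b))"
  have "moment i F \<in> V.N"
  proof (rule V.moment_N_of_roots)
    show "nat_rep ` {a. fourier f a = 0} \<subseteq> {..<CARD('p)}" using nat_rep_less by auto
    show "coeff F n \<in> value_module f" for n
      unfolding F_def coeff_sum coeff_monom using value_mem V.zero_mem
      by (intro V.sum_mem) auto
    show "poly F (root_p TYPE('p) ^ a) = 0" if "a \<in> nat_rep ` {a. fourier f a = 0}" for a
      using that by (auto simp: F_def poly_sum poly_monom fourier_altdef power_mult)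
    show "i < card (nat_rep ` {a. fourier f a = 0})"
      using assms by (simp add: card_image inj_on_subset[OF inj_nat_rep])
  qed simp
  also have "moment i F = value_moment i"
    unfolding F_def moment_sum moment_monom value_moment_def
    by (simp add: of_int_rep)
  finally show ?thesis .
qed

text \<open>Otherwise interpolation on the support puts all values of \<open>f\<close> into
  \<open>N\<close>, so the value module equals \<open>N\<close> and is zero. Keeping
  \<open>mom\<close> abstract allows moments to be supplied both by Fourier zeros and by
  invariance.\<close>

lemma card_supp_greater_of_moments:
  assumes nz: "f \<noteq> (\<lambda>_. 0)" and mom: "\<And>i. i < k \<Longrightarrow> value_moment i \<in> V.N"
  shows "k < card (supp f)"
proof (rule ccontr)
  assume "\<not> k < card (supp f)"
  hence mom': "value_moment i \<in> V.N" if "i < card (supp f)" for i using mom that by simp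
  have supp: "f x \<in> V.N" if "x \<in> supp f" for x
  proof (rule V.mem_N_of_moments[OF _ value_mem _ _ that])
    fix i j :: "'p mod_ring" assume "i \<noteq> j"
    thus "\<not> int CARD('p) dvd to_int_mod_ring i - to_int_mod_ring j"
      by (simp add: of_int_mod_ring_eq_iff_dvd[symmetric] of_int_to_int_mod_ring)
  next
    fix i assume "i < card (supp f)"
    hence "value_moment i \<in> V.N" by (rule mom')
    also have "value_moment i = (\<Sum>j\<in>supp f. f j * of_int (to_int_mod_ring j ^ i))"
      unfolding value_moment_def by (intro sum.mono_neutral_right) (auto simp: supp_def)
    finally show "(\<Sum>j\<in>supp f. f j * of_int (to_int_mod_ring j ^ i)) \<in> V.N" .
  qed simp
  have "f x \<in> V.N" for x
    using supp[of x] V.zero_N by (cases "x \<in> supp f") (auto simp: supp_def)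
  \<comment> \<open>Dividing the values by \<open>1 - w\<close> inside the module carries over to
    the generators \<open>f j * w ^ k\<close>.\<close>
  then obtain g where g: "\<And>x. g x \<in> value_module f" "\<And>x. f x = (1 - root_p TYPE('p)) * g x"
    unfolding V.N_def image_iff by metis
  have "value_module f \<subseteq> V.N"
  proof
    fix y assume "y \<in> value_module f"
    thus "y \<in> V.N"
    proof (induction rule: int_module.span_induct_alt)
      case (step c x y)
      then obtain j k where "x = f j * root_p TYPE('p) ^ k" by (auto simp: value_gens_def)
      hence "x = (1 - root_p TYPE('p)) * (root_p TYPE('p) ^ k * g j)" by (simp add: g(2))
      hence "x \<in> V.N" unfolding V.N_def using V.w_pow_mult_mem[OF g(1)] by blast
      thus ?case using step V.add_N V.of_int_mult_N by blast
    qed (rule V.zero_N)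
  qed
  hence "value_module f = {0}"
    by (rule V.M_trivial_if_subset_N[OF _ finite_value_gens])
       (auto simp: int_module.span_finite[OF finite_value_gens])
  hence "f x = 0" for x using value_mem[of f x] by auto
  thus False using nz by auto
qed

lemma card_fourier_zeros: "card {a. fourier f a = 0} + card (supp (fourier f)) = CARD('p)"
proof -
  have "card {a. fourier f a = 0} + card (supp (fourier f))
      = card ({a. fourier f a = 0} \<union> supp (fourier f))"
    by (intro card_Un_disjoint[symmetric]) (auto simp: supp_def)
  also have "{a. fourier f a = 0} \<union> supp (fourier f) = UNIV" by (auto simp: supp_def)
  finally show ?thesis by simp
qed

theorem uncertainty_prime:
  assumes "f \<noteq> (\<lambda>_. 0)"
  shows "card (supp f) + card (supp (fourier f)) \<ge> CARD('p) + 1"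
proof -
  have "card {a. fourier f a = 0} < card (supp f)"
    by (rule card_supp_greater_of_moments[OF assms value_moment_N_of_fourier_zeros])
  thus ?thesis using card_fourier_zeros by simp
qed

text \<open>Substituting \<open>h * b\<close> for \<open>b\<close> shows that multiplication by
  \<open>h ^ i\<close> fixes the moment modulo \<open>N\<close>, while \<open>h ^ i - 1\<close> is
  invertible modulo \<open>p\<close>.\<close>

lemma value_moment_N_of_invariant:
  assumes inv: "\<And>x. f (h * x) = f x" and h: "h \<noteq> 0" and hi: "h ^ i \<noteq> 1"
  shows "value_moment i \<in> V.N"
proof (rule V.mem_N_of_int_mult[OF value_moment_mem])
  let ?r = "to_int_mod_ring :: 'p mod_ring \<Rightarrow> int"
  have bij: "bij_betw (\<lambda>b. h * b) UNIV UNIV"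
    using h by (intro bij_betwI[of _ _ _ "\<lambda>b. b / h"]) auto
  have eq: "value_moment i = (\<Sum>b\<in>UNIV. f b * of_int (?r (h * b) ^ i))"
    using sum.reindex_bij_betw[OF bij, of "\<lambda>b. f b * of_int (?r b ^ i)"]
    by (simp add: value_moment_def inv)
  \<comment> \<open>The representative of \<open>h * b\<close> agrees with the product of
    representatives only modulo \<open>p\<close>; the error lies in \<open>N\<close> by
    \<open>p_mult_N\<close>.\<close>
  have "of_int (?r h ^ i) * value_moment i - value_moment i
      = (\<Sum>b\<in>UNIV. f b * of_int ((?r h * ?r b) ^ i)) - (\<Sum>b\<in>UNIV. f b * of_int (?r (h * b) ^ i))"
    by (subst (2) eq) (simp add: value_moment_def sum_distrib_left power_mult_distrib mult_ac)
  also have "\<dots> = (\<Sum>b\<in>UNIV. of_int ((?r h * ?r b) ^ i - ?r (h * b) ^ i) * f b)"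
    by (simp add: sum_subtractf[symmetric] algebra_simps)
  also have "\<dots> \<in> V.N"
  proof (rule V.sum_N)
    fix b
    have "int CARD('p) dvd (?r h * ?r b) ^ i - ?r (h * b) ^ i"
      by (subst of_int_mod_ring_eq_iff_dvd[symmetric]) (simp add: of_int_to_int_mod_ring)
    then obtain m where m: "(?r h * ?r b) ^ i - ?r (h * b) ^ i = int CARD('p) * m" by blast
    show "of_int ((?r h * ?r b) ^ i - ?r (h * b) ^ i) * f b \<in> V.N"
      using V.of_int_mult_N[OF V.p_mult_N[OF value_mem], of m b] unfolding m by (simp add: mult_ac)
  qed
  finally show "of_int (?r h ^ i - 1) * value_moment i \<in> V.N" by (simp add: algebra_simps)
  show "\<not> int CARD('p) dvd ?r h ^ i - 1"
    using hi by (simp add: of_int_mod_ring_eq_iff_dvd[symmetric] of_int_to_int_mod_ring)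
qed

end

subsection \<open>Symmetry under a multiplicative subgroup\<close>

lemma subgroup_mult_groupD:
  assumes "subgroup H (mult_group :: 'a::field monoid)"
  shows "1 \<in> H" "0 \<notin> H" "\<And>x y. x \<in> H \<Longrightarrow> y \<in> H \<Longrightarrow> x * y \<in> H"
  using subgroup.one_closed[OF assms] subgroup.subset[OF assms] subgroup.m_closed[OF assms]
  by (auto simp: mult_group_def)

text \<open>Multiplication by \<open>h\<close> permutes \<open>H\<close>; compare the products of
  all elements.\<close>

lemma subgroup_power_card:
  assumes H: "subgroup H (mult_group :: 'a::field monoid)" "finite H" "h \<in> H"
  shows "h ^ card H = 1"
proof -
  note HD = subgroup_mult_groupD[OF H(1)]
  have h0: "h \<noteq> 0" using HD H by auto
  have "inj_on (\<lambda>x. h * x) H" using h0 by (auto simp: inj_on_def)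
  moreover from this have "(\<lambda>x. h * x) ` H = H"
    using HD H by (intro endo_inj_surj) auto
  ultimately have "bij_betw (\<lambda>x. h * x) H H" by (simp add: bij_betw_def)
  hence "\<Prod>H = (\<Prod>x\<in>H. h * x)" using prod.reindex_bij_betw[of _ H H "\<lambda>x. x"] by metis
  also have "\<dots> = h ^ card H * \<Prod>H" by (simp add: prod.distrib)
  finally show ?thesis using HD H(2) by (auto simp: prod_zero_iff)
qed

text \<open>Otherwise all elements of \<open>H\<close> are roots of \<open>X ^ r - 1\<close> for the
  nonzero remainder \<open>r < card H\<close>, too many for its degree.\<close>

lemma card_dvd_if_power_eq_1:
  assumes H: "subgroup H (mult_group :: 'a::field monoid)" "finite H"
    and i: "\<And>h. h \<in> H \<Longrightarrow> h ^ i = 1"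
  shows "card H dvd i"
proof (rule ccontr)
  assume "\<not> card H dvd i"
  define r where "r = i mod card H"
  have r: "r > 0" using \<open>\<not> card H dvd i\<close> by (auto simp: r_def dvd_eq_mod_eq_0)
  have "card H > 0" using H(2) subgroup_mult_groupD(1)[OF H(1)] card_gt_0_iff by blast
  hence rH: "r < card H" by (simp add: r_def)
  have pow: "h ^ r = 1" if "h \<in> H" for h
  proof -
    have "h ^ i = (h ^ card H) ^ (i div card H) * h ^ r"
      unfolding r_def power_mult[symmetric] power_add[symmetric] by simp
    thus ?thesis using i[OF that] subgroup_power_card[OF H that] by simp
  qed
  define q :: "'a poly" where "q = monom 1 r - 1"
  have "coeff q r = 1" using r by (simp add: q_def)
  hence q: "q \<noteq> 0" by auto
  have "card H \<le> card {x. poly q x = 0}"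
    using pow poly_roots_finite[OF q] by (intro card_mono) (auto simp: q_def poly_monom)
  also have "\<dots> \<le> degree q" by (rule card_poly_roots_bound[OF q])
  also have "\<dots> \<le> r"
    unfolding q_def by (intro degree_diff_le) (auto simp: degree_monom_le)
  finally show False using rH by simp
qed

text \<open>\<open>H\<close> acts freely on nonzero elements, so \<open>S\<close> is a disjoint
  union of orbits of size \<open>card H\<close>.\<close>

lemma card_dvd_if_mult_closed:
  assumes H: "subgroup H (mult_group :: 'a::field monoid)" and S: "finite S" "0 \<notin> S"
    and closed: "\<And>h x. h \<in> H \<Longrightarrow> x \<in> S \<Longrightarrow> h * x \<in> S"
  shows "card H dvd card S"
proof -
  note HD = subgroup_mult_groupD[OF H]
  have inv: "inverse h \<in> H" if "h \<in> H" for h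
  proof -
    interpret group "mult_group :: 'a monoid"
      by (rule groupI) (auto simp: mult_group_def intro!: bexI[of _ "inverse _"])
    have "h \<noteq> 0" using that HD by auto
    hence "inv\<^bsub>mult_group\<^esub> h = inverse h"
      by (intro inv_equality) (auto simp: mult_group_def)
    thus ?thesis using subgroup.m_inv_closed[OF H that] by simp
  qed
  define orb where "orb x = (\<lambda>h. h * x) ` H" for x
  have un: "\<Union> (orb ` S) = S"
    using closed HD(1) by (force simp: orb_def)
  have orb_eq: "orb x = orb y" if "z \<in> orb x" "z \<in> orb y" for x y z
  proof -
    have *: "orb x \<subseteq> orb y" if xy: "z \<in> orb x" "z \<in> orb y" for x y z
    proof
      fix u assume "u \<in> orb x"
      obtain h a b where h: "h \<in> H" "u = h * x" "a \<in> H" "z = a * x" "b \<in> H" "z = b * y"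
        using xy \<open>u \<in> orb x\<close> unfolding orb_def by blast
      hence "a \<noteq> 0" using HD by auto
      hence "u = (h * (inverse a * b)) * y" using h by (simp add: field_simps)
      thus "u \<in> orb y" using h HD(3) inv unfolding orb_def by blast
    qed
    show ?thesis using *[OF that] *[OF that(2,1)] by blast
  qed
  have "card H dvd card (\<Union> (orb ` S))"
  proof (rule dvd_partition)
    show "finite (\<Union> (orb ` S))" using S un by simp
    have "card (orb x) = card H" if "x \<in> S" for x
      unfolding orb_def using that S by (intro card_image) (auto simp: inj_on_def)
    thus "\<forall>c\<in>orb ` S. card H dvd card c" by auto
    show "\<forall>c1\<in>orb ` S. \<forall>c2\<in>orb ` S. c1 \<noteq> c2 \<longrightarrow> c1 \<inter> c2 = {}"
      using orb_eq by blast
  qed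
  thus ?thesis by (simp add: un)
qed

section \<open>Counting \<open>H\<close>-orbits in both supports\<close>

theorem theorem1p5:
  fixes H :: "'p::prime_card mod_ring set"
    and \<chi> :: "'p mod_ring \<Rightarrow> complex"
    and f :: "'p mod_ring \<Rightarrow> complex"
  assumes "subgroup H mult_group"
    and "is_character H \<chi>"
    and "chi_symmetric H \<chi> f"
    and "f \<noteq> (\<lambda>_. 0)"
  shows "(\<not> trivial_character H \<chi> \<longrightarrow>
            card (supp f) + card (supp (fourier f)) \<ge> CARD('p) + card H - 1) \<and>
         (trivial_character H \<chi> \<longrightarrow>
            card (supp f) + card (supp (fourier f)) \<ge>
              (if f 0 = 0 \<and> fourier f 0 = 0 then CARD('p) + 2 * card H - 1
               else if f 0 = 0 \<or> fourier f 0 = 0 then CARD('p) + card H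
               else CARD('p) + 1))"
proof -
  note H = assms(1) and HD = subgroup_mult_groupD[OF assms(1)]
  have \<chi>0: "\<chi> h \<noteq> 0" if "h \<in> H" for h
    using assms(2) that by (auto simp: is_character_def hom_def mult_group_def)
  have sym: "f (h * x) = \<chi> h * f x" if "h \<in> H" for h x
    using assms(3) that by (auto simp: chi_symmetric_def)
  have fsym: "\<chi> h * fourier f (h * x) = fourier f x" if "h \<in> H" for h x
    using fourier_scale[of f h "\<chi> h" x] sym[OF that] HD that by metis
  have h0: "h \<noteq> 0" if "h \<in> H" for h using HD that by auto
  have Hpos: "card H > 0" using HD(1) card_gt_0_iff[of H] by auto
  \<comment> \<open>The numbers \<open>s\<close>, \<open>t\<close> and \<open>n\<close> obtained
    below count the orbits in the two supports without 0 and in the whole multiplicative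
    group.\<close>
  have "card H dvd card (supp f - {0})"
    using sym \<chi>0 h0 by (intro card_dvd_if_mult_closed[OF H]) (auto simp: supp_def)
  then obtain s where s: "card (supp f - {0}) = card H * s" by blast
  have "card H dvd card (supp (fourier f) - {0})"
  proof (rule card_dvd_if_mult_closed[OF H])
    fix h x assume "h \<in> H" "x \<in> supp (fourier f) - {0}"
    thus "h * x \<in> supp (fourier f) - {0}"
      using fsym[of h x] h0[of h] by (auto simp: supp_def)
  qed auto
  then obtain t where t: "card (supp (fourier f) - {0}) = card H * t" by blast
  have "card H dvd card (UNIV - {0 :: 'p mod_ring})"
    using h0 by (intro card_dvd_if_mult_closed[OF H]) auto
  then obtain n where "card (UNIV - {0 :: 'p mod_ring}) = card H * n" by blast
  hence "CARD('p) - 1 = card H * n" by (simp add: card_Diff_subset)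
  hence n: "CARD('p) = card H * n + 1"
    using prime_gt_0_nat[OF prime_card[where 'a = 'p]] by linarith
  have split_0: "card A = card (A - {0}) + (if 0 \<in> A then 1 else 0)" for A :: "'p mod_ring set"
    using card.remove[of A 0] by auto
  have s': "card (supp f) = card H * s + (if f 0 = 0 then 0 else 1)"
    using split_0[of "supp f"] s by (simp add: supp_def)
  have t': "card (supp (fourier f)) = card H * t + (if fourier f 0 = 0 then 0 else 1)"
    using split_0[of "supp (fourier f)"] t by (simp add: supp_def)
  have unc: "card (supp f) + card (supp (fourier f)) \<ge> CARD('p) + 1"
    by (rule uncertainty_prime[OF assms(4)])
  \<comment> \<open>At most one of the supports contains 0, so \<open>unc\<close> gives
    \<open>card H * (s + t) + 1 \<ge> card H * n + 2\<close>.\<close>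
  have one: "n + 1 \<le> s + t" if "f 0 = 0 \<or> fourier f 0 = 0"
  proof (rule ccontr)
    assume "\<not> n + 1 \<le> s + t"
    hence "card H * (s + t) \<le> card H * n" by (intro mult_le_mono) auto
    thus False using unc s' t' n that by (auto simp: algebra_simps split: if_splits)
  qed
  hence one': "card H * (s + t) \<ge> card H * n + card H" if "f 0 = 0 \<or> fourier f 0 = 0"
    using mult_le_mono2[OF one[OF that], of "card H"] by (simp add: algebra_simps)
  have two: "n + 2 \<le> s + t" if triv: "trivial_character H \<chi>" and z: "f 0 = 0" "fourier f 0 = 0"
  proof -
    have "t \<le> n"
    proof -
      have "card {a. fourier f a = 0} > 0" using z by (auto simp: card_gt_0_iff)
      moreover have "card (supp (fourier f)) = card H * t" using t' z by simp
      ultimately have "card H * t \<le> card H * n" using card_fourier_zeros[of f] n by linarith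
      thus ?thesis using Hpos by simp
    qed
    \<comment> \<open>The zeros are the point 0 and \<open>n - t\<close> full orbits.\<close>
    have zeros: "card {a. fourier f a = 0} = card H * (n - t) + 1"
    proof -
      have "card H * n = card H * t + card H * (n - t)"
        using \<open>t \<le> n\<close> by (simp flip: distrib_left)
      thus ?thesis using card_fourier_zeros[of f] t' z n by simp
    qed
    \<comment> \<open>A multiple of \<open>card H\<close> below this bound is at most
      \<open>card H * (n - t)\<close>, just less than the number of zeros thanks to the zero at 0.
      All other moments are handled by invariance.\<close>
    have "card H * (n - t + 1) < card (supp f)"
    proof (rule card_supp_greater_of_moments[OF assms(4)])
      fix i assume i: "i < card H * (n - t + 1)"
      show "value_moment f i \<in> cyclotomic_module.N (root_p TYPE('p)) (value_module f)"
      proof (cases "card H dvd i")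
        case True
        then obtain k where k: "i = card H * k" by blast
        hence "k < n - t + 1" using i by (simp only: mult_less_cancel1)
        hence "k \<le> n - t" by simp
        hence "i < card {a. fourier f a = 0}" unfolding zeros k by (simp add: less_Suc_eq_le)
        thus ?thesis by (rule value_moment_N_of_fourier_zeros)
      next
        case False
        then obtain h where "h \<in> H" "h ^ i \<noteq> 1" using card_dvd_if_power_eq_1[OF H, of i] by auto
        thus ?thesis using sym triv h0
          by (intro value_moment_N_of_invariant[of f h]) (auto simp: trivial_character_def)
      qed
    qed
    moreover have "card (supp f) = card H * s" using s' z by simp
    ultimately have "n - t + 1 < s" by (simp only: mult_less_cancel1)
    thus ?thesis using \<open>t \<le> n\<close> by simp
  qed
  show ?thesis
  proof (intro conjI impI)
    assume "\<not> trivial_character H \<chi>"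
    then obtain h where h: "h \<in> H" "\<chi> h \<noteq> 1" by (auto simp: trivial_character_def)
    \<comment> \<open>At the fixed point 0, symmetry multiplies the value by a factor other than 1,
      for \<open>f\<close> and for its transform.\<close>
    have "f 0 = 0" "fourier f 0 = 0" using sym[OF h(1), of 0] fsym[OF h(1), of 0] h by auto
    thus "card (supp f) + card (supp (fourier f)) \<ge> CARD('p) + card H - 1"
      using one' s' t' n by (simp add: algebra_simps)
  next
    assume triv: "trivial_character H \<chi>"
    have two': "card H * (s + t) \<ge> card H * n + 2 * card H" if "f 0 = 0" "fourier f 0 = 0"
      using mult_le_mono2[OF two[OF triv that], of "card H"] by (simp add: algebra_simps)
    show "card (supp f) + card (supp (fourier f)) \<ge>
              (if f 0 = 0 \<and> fourier f 0 = 0 then CARD('p) + 2 * card H - 1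
               else if f 0 = 0 \<or> fourier f 0 = 0 then CARD('p) + card H
               else CARD('p) + 1)"
      using two' one' unc s' t' n by (auto simp: algebra_simps)
  qed
qed

end
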